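(* Let $G$ be a finite abelian group of odd order and $S$ a sequence over $G$ such that $0$ is not a term of $S$ and $N_0(S) = 2^{|S|-D(G)+1}$. Then $S$ contains exactly $|S|-D(G)+1$ minimal zero-sum subsequences, and these are pairwise disjoint.
   Context: A sequence over $G$ is a finite unordered list $S = g_1 \cdots g_m$ of elements of $G$ with repetition allowed (an element of the free abelian monoid on $G$); $|S| = m$; subsequences are sub-multisets (divisors in this monoid). $N_0(S) = |\{I \subseteq [1,m] : \sum_{i\in I} g_i = 0\}|$ (empty index set included). $D(G)$ is the smallest positive integer $\ell$ such that every sequence over $G$ of length at least $\ell$ has a nonempty subsequence with sum $0$. A minimal zero-sum sequence is a nonempty sequence with sum $0$ none of whose nonempty proper subsequences has sum $0$. Two subsequences $T_1,T_2$ are disjoint if their greatest common divisor $\gcd(T_1,T_2)$ (the longest sequence dividing both) is the empty sequence. *)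

theory Defs
  imports Complex_Main "HOL-Library.Multiset" "HOL-Library.Cardinality" "HOL-Combinatorics.List_Permutation"
begin

text \<open>Sequences over the group \<open>G\<close> are multisets over the type \<open>'a\<close>; the length is \<open>size\<close>,
  subsequences are given by \<open>\<subseteq>#\<close>, and the greatest common divisor is \<open>\<inter>#\<close>.\<close>

definition davenport :: "'a::ab_group_add itself \<Rightarrow> nat" where
  "davenport _ = (LEAST l. 0 < l \<and>
     (\<forall>S :: 'a multiset. l \<le> size S \<longrightarrow> (\<exists>T. T \<subseteq># S \<and> T \<noteq> {#} \<and> \<Sum>\<^sub># T = 0)))"

definition minimal_zero_sum :: "'a::ab_group_add multiset \<Rightarrow> bool" where
  "minimal_zero_sum S \<longleftrightarrow> S \<noteq> {#} \<and> \<Sum>\<^sub># S = 0 \<and>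
     (\<forall>T. T \<subset># S \<and> T \<noteq> {#} \<longrightarrow> \<Sum>\<^sub># T \<noteq> 0)"

text \<open>Index sets refer to an enumeration \<open>g\<^sub>1 \<cdots> g\<^sub>m\<close> of the terms. The enumeration
  is chosen arbitrarily; lemma \<open>N0_mset\<close> shows that the count does not depend on it.\<close>

definition N0 :: "'a::ab_group_add multiset \<Rightarrow> nat" where
  "N0 S = (let g = (SOME g. mset g = S) in
     card {I. I \<subseteq> {..<length g} \<and> (\<Sum>i\<in>I. g ! i) = 0})"

lemma card_zero_sum_index_sets_cong:
  fixes xs ys :: "'a::ab_group_add list"
  assumes "mset xs = mset ys"
  shows "card {I. I \<subseteq> {..<length xs} \<and> (\<Sum>i\<in>I. xs ! i) = 0} =
         card {I. I \<subseteq> {..<length ys} \<and> (\<Sum>i\<in>I. ys ! i) = 0}"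
proof -
  obtain f where f: "bij_betw f {..<length xs} {..<length ys}"
    and nth: "\<And>i. i < length xs \<Longrightarrow> xs ! i = ys ! f i"
    using permutation_Ex_bij[OF assms] by blast
  have sum_image: "(\<Sum>j\<in>f ` I. ys ! j) = (\<Sum>i\<in>I. xs ! i)" if "I \<subseteq> {..<length xs}" for I
  proof -
    have "inj_on f I"
      using f that by (meson bij_betw_def inj_on_subset)
    then have "(\<Sum>j\<in>f ` I. ys ! j) = (\<Sum>i\<in>I. ys ! f i)"
      by (simp add: sum.reindex)
    also have "\<dots> = (\<Sum>i\<in>I. xs ! i)"
      using that nth by (intro sum.cong) auto
    finally show ?thesis .
  qed
  have "bij_betw ((`) f) (Pow {..<length xs}) (Pow {..<length ys})"
    using f by (rule bij_betw_Pow)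
  then have inj: "inj_on ((`) f) (Pow {..<length xs})"
    and img: "(`) f ` Pow {..<length xs} = Pow {..<length ys}"
    by (simp_all only: bij_betw_def)
  let ?A = "{I. I \<subseteq> {..<length xs} \<and> (\<Sum>i\<in>I. xs ! i) = 0}"
  let ?B = "{I. I \<subseteq> {..<length ys} \<and> (\<Sum>i\<in>I. ys ! i) = 0}"
  have "(`) f ` ?A = ?B"
  proof (intro equalityI subsetI)
    fix J assume "J \<in> (`) f ` ?A"
    then obtain I where I: "I \<subseteq> {..<length xs}" "(\<Sum>i\<in>I. xs ! i) = 0" "J = f ` I"
      by auto
    moreover have "f ` I \<subseteq> {..<length ys}"
      using f I(1) by (auto simp: bij_betw_def)
    ultimately show "J \<in> ?B"
      using sum_image[OF I(1)] by simp
  next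
    fix J assume J: "J \<in> ?B"
    then have "J \<in> (`) f ` Pow {..<length xs}"
      by (simp add: img)
    then obtain I where I: "I \<subseteq> {..<length xs}" "J = f ` I"
      by (elim imageE) simp
    have "I \<in> ?A"
      using J I sum_image[OF I(1)] by simp
    then show "J \<in> (`) f ` ?A"
      unfolding I(2) by (rule imageI)
  qed
  moreover have "inj_on ((`) f) ?A"
    using inj by (rule inj_on_subset) auto
  ultimately show ?thesis
    using card_image[of "(`) f" ?A] by simp
qed

lemma N0_mset:
  "N0 (mset g) = card {I. I \<subseteq> {..<length g} \<and> (\<Sum>i\<in>I. g ! i) = 0}"
proof -
  have "mset (SOME g'. mset g' = mset g) = mset g"
    by (rule someI) simp
  then show ?thesis
    unfolding N0_def Let_def by (rule card_zero_sum_index_sets_cong)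
qed

end

theory Submission
  imports Defs
begin

text \<open>Enumerate \<open>S\<close> by an index set \<open>X\<close>, write \<open>\<sigma>(I)\<close> for the sum of the terms with index in \<open>I\<close>,
  and let \<open>F\<close> be the family of zero-sum subsets of \<open>X\<close>, with union \<open>U\<close>. By induction on \<open>|X|\<close>, every attained sum is attained at least \<open>2 ^ (|X| - D(G) + 1)\<close>
  times. If \<open>F\<close> has exactly this size, then for each \<open>i \<in> U\<close> the members of \<open>F\<close> containing \<open>i\<close> and
  those avoiding \<open>i\<close> are equally many, so counting each \<open>i \<in> U\<close> over all members gives
  \<open>0 = \<Sum>\<^bsub>I \<in> F\<^esub> \<sigma>(I) = \<Sum>\<^bsub>I \<in> F\<^esub> \<sigma>(U - I) = |F| \<sigma>(U)\<close>. As \<open>|F|\<close> is a power of two and \<open>|G|\<close> is odd,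
  \<open>\<sigma>(U) = 0\<close>. The family of \<open>X - {i}\<close> is extremal as well, so among the zero-sum sets avoiding \<open>i\<close>
  there is a largest one; its complement in \<open>U\<close> is the least zero-sum set containing \<open>i\<close>. Hence
  minimal zero-sum sets are disjoint, and \<open>F\<close> consists of their unions.\<close>

section \<open>Multiples in finite groups\<close>

lemma sum_const_cong:
  fixes x :: "'a::comm_monoid_add"
  assumes "finite A" "finite B" "card A = card B"
  shows "(\<Sum>_\<in>A. x) = (\<Sum>_\<in>B. x)"
proof -
  obtain f where "bij_betw f A B"
    using finite_same_card_bij[OF assms] by blast
  then show ?thesis
    by (rule sum.reindex_bij_betw)
qed

lemma sum_const_UNIV_eq_0:
  fixes x :: "'a::{ab_group_add, finite}"
  shows "(\<Sum>_\<in>(UNIV :: 'a set). x) = 0"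
proof -
  have "(\<Sum>y\<in>UNIV. y) = (\<Sum>y\<in>UNIV. y + x)"
    by (rule sum.reindex_bij_witness[of _ "\<lambda>y. y + x" "\<lambda>y. y - x"]) auto
  then show ?thesis
    by (simp add: sum.distrib)
qed

lemma coprime_sum_const_eq_0_imp_eq_0:
  fixes x :: "'a::{ab_group_add, finite}"
  assumes "finite A" "coprime (card A) CARD('a)" "(\<Sum>_\<in>A. x) = 0"
  shows "x = 0"
proof -
  obtain u v where bezout: "CARD('a) * u = card A * v + 1"
    using bezout_nat[of "CARD('a)" "card A"] coprime_imp_gcd_eq_1[OF assms(2)]
    by (auto simp: gcd.commute)
  have "(\<Sum>_\<in>{..<u}. \<Sum>_\<in>(UNIV :: 'a set). x) = (\<Sum>_\<in>{..<CARD('a) * u}. x)"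
    unfolding sum.cartesian_product by (auto intro: sum_const_cong)
  moreover have "(\<Sum>_\<in>{..<v}. \<Sum>_\<in>A. x) = (\<Sum>_\<in>{..<card A * v}. x)"
    unfolding sum.cartesian_product using assms(1) by (auto intro: sum_const_cong)
  ultimately show ?thesis
    by (simp add: bezout sum_const_UNIV_eq_0 assms(3))
qed

section \<open>Index sets with a given sum\<close>

definition sets_with_sum :: "('i \<Rightarrow> 'a::ab_group_add) \<Rightarrow> 'i set \<Rightarrow> 'a \<Rightarrow> 'i set set" where
  "sets_with_sum g X h = {I. I \<subseteq> X \<and> sum g I = h}"

abbreviation zero_sum_sets :: "('i \<Rightarrow> 'a::ab_group_add) \<Rightarrow> 'i set \<Rightarrow> 'i set set" where
  "zero_sum_sets g X \<equiv> sets_with_sum g X 0"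

definition minimal_zero_sum_sets :: "('i \<Rightarrow> 'a::ab_group_add) \<Rightarrow> 'i set \<Rightarrow> 'i set set" where
  "minimal_zero_sum_sets g X =
    {I \<in> zero_sum_sets g X. I \<noteq> {} \<and> (\<forall>J. J \<subset> I \<and> J \<noteq> {} \<longrightarrow> sum g J \<noteq> 0)}"

lemma mem_sets_with_sum_iff: "I \<in> sets_with_sum g X h \<longleftrightarrow> I \<subseteq> X \<and> sum g I = h"
  by (simp add: sets_with_sum_def)

lemma finite_sets_with_sum: "finite X \<Longrightarrow> finite (sets_with_sum g X h)"
  by (simp add: sets_with_sum_def)

lemma minimal_zero_sum_setsD:
  assumes "I \<in> minimal_zero_sum_sets g X"
  shows "I \<in> zero_sum_sets g X" "I \<noteq> {}"
    and "\<And>J. J \<in> zero_sum_sets g X \<Longrightarrow> J \<subseteq> I \<Longrightarrow> J \<noteq> {} \<Longrightarrow> J = I"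
  using assms by (auto simp: minimal_zero_sum_sets_def mem_sets_with_sum_iff)

lemma zero_sum_sets_Diff:
  assumes "finite X" "I \<in> zero_sum_sets g X" "J \<in> zero_sum_sets g X" "J \<subseteq> I"
  shows "I - J \<in> zero_sum_sets g X"
  using assms finite_subset[of I X] by (auto simp: mem_sets_with_sum_iff sum_diff)

lemma sets_with_sum_avoiding: "{I \<in> sets_with_sum g X h. i \<notin> I} = sets_with_sum g (X - {i}) h"
  by (auto simp: mem_sets_with_sum_iff)

lemma bij_betw_insert_sets_with_sum:
  assumes "finite X" "i \<in> X"
  shows "bij_betw (insert i) (sets_with_sum g (X - {i}) (h - g i)) {I \<in> sets_with_sum g X h. i \<in> I}"
proof (rule bij_betw_byWitness[where f' = "\<lambda>I. I - {i}"])
  have fin: "finite I" if "I \<subseteq> X" for I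
    using that assms(1) by (rule finite_subset)
  show "insert i ` sets_with_sum g (X - {i}) (h - g i) \<subseteq> {I \<in> sets_with_sum g X h. i \<in> I}"
    using assms fin by (auto simp: mem_sets_with_sum_iff subset_Diff_insert)
  show "(\<lambda>I. I - {i}) ` {I \<in> sets_with_sum g X h. i \<in> I} \<subseteq> sets_with_sum g (X - {i}) (h - g i)"
    using fin by (auto simp: mem_sets_with_sum_iff sum_diff1)
qed (auto simp: mem_sets_with_sum_iff)

lemma card_sets_with_sum_containing:
  assumes "finite X" "i \<in> X"
  shows "card {I \<in> sets_with_sum g X h. i \<in> I} = card (sets_with_sum g (X - {i}) (h - g i))"
  using bij_betw_insert_sets_with_sum[OF assms, of g h] by (simp add: bij_betw_same_card)

lemma card_sets_with_sum_remove:
  assumes "finite X" "i \<in> X"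
  shows "card (sets_with_sum g X h) =
    card (sets_with_sum g (X - {i}) h) + card (sets_with_sum g (X - {i}) (h - g i))"
proof -
  let ?F = "sets_with_sum g X h"
  have "card ?F = card ({I \<in> ?F. i \<notin> I} \<union> {I \<in> ?F. i \<in> I})"
    by (rule arg_cong[of _ _ card]) blast
  also have "\<dots> = card {I \<in> ?F. i \<notin> I} + card {I \<in> ?F. i \<in> I}"
    using finite_sets_with_sum[OF assms(1), of g h] by (intro card_Un_disjoint) auto
  finally show ?thesis
    by (simp add: sets_with_sum_avoiding card_sets_with_sum_containing[OF assms])
qed

lemma sum_sym_diff:
  fixes g :: "'i \<Rightarrow> 'a::ab_group_add"
  assumes "finite I" "finite Z"
  shows "sum g (sym_diff I Z) = sum g I + (\<Sum>i\<in>Z. if i \<in> I then - g i else g i)"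
proof -
  have "sum g (sym_diff I Z) = sum g (I - Z) + sum g (Z - I)"
    using assms by (intro sum.union_disjoint) auto
  moreover have "sum g I = sum g (I \<inter> Z) + sum g (I - Z)"
    using assms(1) by (rule sum.Int_Diff)
  moreover have "(\<Sum>i\<in>Z. if i \<in> I then - g i else g i) = sum g (Z - I) - sum g (I \<inter> Z)"
    using assms by (simp add: sum.If_cases sum_negf Diff_eq Collect_neg_eq Int_commute)
  ultimately show ?thesis
    by simp
qed

lemma sum_sum_Int_eq_sum_sum_Diff:
  fixes g :: "'i \<Rightarrow> 'a::comm_monoid_add"
  assumes "finite \<F>" "finite U"
    and half: "\<And>i. i \<in> U \<Longrightarrow> card {I \<in> \<F>. i \<in> I} = card {I \<in> \<F>. i \<notin> I}"
  shows "(\<Sum>I\<in>\<F>. sum g (U \<inter> I)) = (\<Sum>I\<in>\<F>. sum g (U - I))"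
proof -
  have "(\<Sum>I\<in>\<F>. sum g (U \<inter> I)) = (\<Sum>I\<in>\<F>. sum g {i \<in> U. i \<in> I})"
    by (simp add: Int_def)
  also have "\<dots> = (\<Sum>i\<in>U. \<Sum>I\<in>{I \<in> \<F>. i \<in> I}. g i)"
    using assms(1,2) by (rule sum.swap_restrict)
  also have "\<dots> = (\<Sum>i\<in>U. \<Sum>I\<in>{I \<in> \<F>. i \<notin> I}. g i)"
    using assms(1) half by (intro sum.cong sum_const_cong) auto
  also have "\<dots> = (\<Sum>I\<in>\<F>. sum g {i \<in> U. i \<notin> I})"
    using assms(2,1) by (rule sum.swap_restrict)
  also have "\<dots> = (\<Sum>I\<in>\<F>. sum g (U - I))"
    by (simp add: set_diff_eq)
  finally show ?thesis .
qed

lemma ex_minimal_zero_sum_set: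
  assumes "finite X" "Z \<in> zero_sum_sets g X" "i \<in> Z"
  obtains I where "I \<in> minimal_zero_sum_sets g X" "i \<in> I" "I \<subseteq> Z"
proof -
  let ?C = "{I \<in> zero_sum_sets g X. i \<in> I \<and> I \<subseteq> Z}"
  have "finite ?C" "Z \<in> ?C"
    using assms by (simp_all add: finite_sets_with_sum)
  then obtain I where "I \<in> ?C" and I_minimal: "\<forall>J\<in>?C. J \<subseteq> I \<longrightarrow> I = J"
    using finite_has_minimal[of ?C] by auto
  then have I: "I \<in> zero_sum_sets g X" "i \<in> I" "I \<subseteq> Z"
    by auto
  have minimal: "I = J" if "J \<in> zero_sum_sets g X" "i \<in> J" "J \<subseteq> I" for J
    using that I_minimal subset_trans[OF that(3) I(3)] by simp
  have "sum g J \<noteq> 0" if J: "J \<subset> I" "J \<noteq> {}" for J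
  proof
    assume "sum g J = 0"
    then have "J \<in> zero_sum_sets g X"
      using I(1) J(1) by (auto simp: mem_sets_with_sum_iff)
    moreover from this have "I - J \<in> zero_sum_sets g X"
      using zero_sum_sets_Diff[OF assms(1) I(1)] J(1) by blast
    ultimately show False
      using minimal[of J] minimal[of "I - J"] I(2) J by blast
  qed
  then have "I \<in> minimal_zero_sum_sets g X"
    using I(1,2) unfolding minimal_zero_sum_sets_def by blast
  then show thesis
    using that I(2,3) by blast
qed

lemma Union_minimal_zero_sum_sets_mem:
  assumes "finite X" "pairwise disjnt (minimal_zero_sum_sets g X)" "\<M> \<subseteq> minimal_zero_sum_sets g X"
  shows "\<Union>\<M> \<in> zero_sum_sets g X"
proof -
  have \<M>: "\<forall>I\<in>\<M>. I \<subseteq> X \<and> sum g I = 0"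
    using assms(3) minimal_zero_sum_setsD(1) by (fastforce simp: mem_sets_with_sum_iff)
  then have "\<forall>I\<in>\<M>. finite I"
    using assms(1) finite_subset by blast
  moreover have "\<forall>I\<in>\<M>. \<forall>J\<in>\<M>. I \<noteq> J \<longrightarrow> I \<inter> J = {}"
    using assms(2,3) by (auto simp: pairwise_def disjnt_def)
  ultimately have "sum g (\<Union>\<M>) = sum (sum g) \<M>"
    by (simp add: sum.Union_disjoint)
  also have "\<dots> = 0"
    using \<M> by (simp add: sum.neutral)
  finally show ?thesis
    using \<M> by (auto simp: mem_sets_with_sum_iff)
qed

lemma card_zero_sum_sets_if_disjoint:
  assumes "finite X" "pairwise disjnt (minimal_zero_sum_sets g X)"
  shows "card (zero_sum_sets g X) = 2 ^ card (minimal_zero_sum_sets g X)"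
proof -
  let ?M = "minimal_zero_sum_sets g X"
  have "bij_betw Union (Pow ?M) (zero_sum_sets g X)"
  proof (rule bij_betw_byWitness[where f' = "\<lambda>Z. {I \<in> ?M. I \<subseteq> Z}"])
    show "\<forall>\<M>\<in>Pow ?M. {I \<in> ?M. I \<subseteq> \<Union>\<M>} = \<M>"
    proof (intro ballI equalityI subsetI)
      fix \<M> I assume \<M>: "\<M> \<in> Pow ?M" and I: "I \<in> {I \<in> ?M. I \<subseteq> \<Union>\<M>}"
      then obtain i J where "i \<in> I" "i \<in> J" "J \<in> \<M>"
        using minimal_zero_sum_setsD(2)[of I g X] by blast
      then have "I = J"
        using assms(2) \<M> I by (auto simp: pairwise_def disjnt_def)
      then show "I \<in> \<M>"
        using \<open>J \<in> \<M>\<close> by simp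
    qed blast
    show "\<forall>Z\<in>zero_sum_sets g X. \<Union>{I \<in> ?M. I \<subseteq> Z} = Z"
      using ex_minimal_zero_sum_set[OF assms(1)] by blast
    show "Union ` Pow ?M \<subseteq> zero_sum_sets g X"
      using Union_minimal_zero_sum_sets_mem[OF assms] by blast
  qed blast
  then have "card (zero_sum_sets g X) = card (Pow ?M)"
    by (simp add: bij_betw_same_card)
  moreover have "finite ?M"
    using assms(1) by (simp add: minimal_zero_sum_sets_def finite_sets_with_sum)
  ultimately show ?thesis
    by (simp add: card_Pow)
qed

section \<open>Subsequences given by index sets\<close>

abbreviation terms :: "('i \<Rightarrow> 'a) \<Rightarrow> 'i set \<Rightarrow> 'a multiset" where
  "terms g I \<equiv> image_mset g (mset_set I)"

lemma terms_nth: "terms ((!) xs) {..<length xs} = mset xs"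
  by (metis map_nth mset_map mset_set_upto_eq_mset_upto)

lemma sum_mset_terms: "\<Sum>\<^sub># (terms g I) = sum g I"
  by (simp add: sum_unfold_sum_mset)

lemma terms_mono:
  assumes "J \<subseteq> I" "finite I"
  shows "terms g J \<subseteq># terms g I"
  using assms by (intro image_mset_subseteq_mono subset_imp_msubset_mset_set)

lemma terms_strict_mono:
  assumes "J \<subset> I" "finite I"
  shows "terms g J \<subset># terms g I"
  using assms terms_mono[of J I g] psubset_card_mono[of I J]
  by (auto simp: subset_mset.less_le dest: arg_cong[of _ _ size])

lemma subseteq_terms:
  assumes "finite X" "T \<subseteq># terms g X"
  obtains I where "I \<subseteq> X" "T = terms g I"
proof -
  obtain N where N: "N \<subseteq># mset_set X" "T = image_mset g N"
    using assms(2) by (metis image_mset_eq_plusD mset_subset_eq_exists_conv mset_subset_eq_add_left)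
  moreover have "N = mset_set (set_mset N)"
  proof (rule multiset_eqI)
    fix x
    have "count N x \<le> count (mset_set X) x"
      using N(1) by (rule mset_subset_eq_count)
    also have "\<dots> \<le> 1"
      by (simp add: count_mset_set')
    finally show "count N x = count (mset_set (set_mset N)) x"
      by (cases "x \<in># N") (simp_all add: le_Suc_eq count_eq_zero_iff)
  qed
  ultimately show thesis
    using that[of "set_mset N"] assms(1) set_mset_mono[OF N(1)] by auto
qed

lemma mem_minimal_zero_sum_sets_iff:
  assumes "finite X" "I \<subseteq> X"
  shows "I \<in> minimal_zero_sum_sets g X \<longleftrightarrow> minimal_zero_sum (terms g I)"
proof -
  have fin: "finite I"
    using assms finite_subset by blast
  have nonempty: "terms g J \<noteq> {#} \<longleftrightarrow> J \<noteq> {}" if "J \<subseteq> I" for J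
    using finite_subset[OF that fin] by (simp add: mset_set_empty_iff)
  have "(\<forall>T. T \<subset># terms g I \<and> T \<noteq> {#} \<longrightarrow> \<Sum>\<^sub># T \<noteq> 0) \<longleftrightarrow>
    (\<forall>J. J \<subset> I \<and> J \<noteq> {} \<longrightarrow> sum g J \<noteq> 0)" (is "?min_terms \<longleftrightarrow> ?min_sets")
  proof
    assume ?min_terms
    then show ?min_sets
      using terms_strict_mono[OF _ fin, of _ g] nonempty by (metis psubset_imp_subset sum_mset_terms)
  next
    assume ?min_sets
    show ?min_terms
    proof (intro allI impI)
      fix T assume T: "T \<subset># terms g I \<and> T \<noteq> {#}"
      then obtain J where "J \<subseteq> I" "T = terms g J"
        using subseteq_terms[OF fin] subset_mset.less_imp_le by metis
      moreover from this have "J \<noteq> I" "J \<noteq> {}"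
        using T by auto
      ultimately show "\<Sum>\<^sub># T \<noteq> 0"
        using \<open>?min_sets\<close> by (simp add: sum_mset_terms psubset_eq)
    qed
  qed
  then show ?thesis
    using assms(2) nonempty[of I]
    by (simp add: minimal_zero_sum_sets_def minimal_zero_sum_def sum_mset_terms mem_sets_with_sum_iff
        conj_left_commute)
qed

lemma image_terms_minimal_zero_sum_sets:
  assumes "finite X"
  shows "terms g ` minimal_zero_sum_sets g X = {T. T \<subseteq># terms g X \<and> minimal_zero_sum T}"
proof (intro equalityI subsetI)
  fix T assume "T \<in> terms g ` minimal_zero_sum_sets g X"
  then obtain I where "I \<in> minimal_zero_sum_sets g X" "T = terms g I"
    by blast
  moreover from this have "I \<subseteq> X"
    using minimal_zero_sum_setsD(1) by (auto simp: mem_sets_with_sum_iff)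
  ultimately show "T \<in> {T. T \<subseteq># terms g X \<and> minimal_zero_sum T}"
    using assms mem_minimal_zero_sum_sets_iff terms_mono by blast
next
  fix T assume T: "T \<in> {T. T \<subseteq># terms g X \<and> minimal_zero_sum T}"
  then obtain I where "I \<subseteq> X" "T = terms g I"
    using subseteq_terms[OF assms] by blast
  then show "T \<in> terms g ` minimal_zero_sum_sets g X"
    using T assms mem_minimal_zero_sum_sets_iff by blast
qed

section \<open>The Davenport constant\<close>

lemma ex_zero_sum_interval:
  fixes g :: "nat \<Rightarrow> 'a::{ab_group_add, finite}"
  assumes "CARD('a) \<le> n"
  obtains k m where "k < m" "m \<le> n" "sum g {k..<m} = 0"
proof -
  have "\<not> inj_on (\<lambda>m. sum g {..<m}) {..n}"
  proof
    assume "inj_on (\<lambda>m. sum g {..<m}) {..n}"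
    then have "card {..n} \<le> CARD('a)"
      by (rule card_inj_on_le) auto
    then show False
      using assms by simp
  qed
  then obtain k m where km: "k < m" "m \<le> n" "sum g {..<k} = sum g {..<m}"
    unfolding inj_on_def by (metis atMost_iff linorder_neqE_nat)
  have "sum g {k..<m} = sum g {..<m} - sum g {..<k}"
    using km(1) by (simp add: atLeast0LessThan[symmetric] sum_diff_nat_ivl)
  then show thesis
    using that km by simp
qed

lemma ex_zero_sum_subsequence_card:
  fixes S :: "'a::{ab_group_add, finite} multiset"
  assumes "CARD('a) \<le> size S"
  shows "\<exists>T. T \<subseteq># S \<and> T \<noteq> {#} \<and> \<Sum>\<^sub># T = 0"
proof -
  obtain xs where xs: "mset xs = S"
    using ex_mset by blast
  then obtain k m where km: "k < m" "m \<le> length xs" "sum ((!) xs) {k..<m} = 0"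
    using ex_zero_sum_interval assms by (metis size_mset)
  have "terms ((!) xs) {k..<m} \<subseteq># S"
    unfolding xs[symmetric] terms_nth[of xs, symmetric] using km(2) by (intro terms_mono) auto
  then show ?thesis
    using km by (intro exI[of _ "terms ((!) xs) {k..<m}"]) (simp add: sum_mset_terms mset_set_empty_iff)
qed

lemma ex_zero_sum_subsequence_davenport:
  fixes S :: "'a::{ab_group_add, finite} multiset"
  assumes "davenport TYPE('a) \<le> size S"
  shows "\<exists>T. T \<subseteq># S \<and> T \<noteq> {#} \<and> \<Sum>\<^sub># T = 0"
proof -
  let ?P = "\<lambda>l. 0 < l \<and> (\<forall>S :: 'a multiset. l \<le> size S \<longrightarrow> (\<exists>T. T \<subseteq># S \<and> T \<noteq> {#} \<and> \<Sum>\<^sub># T = 0))"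
  have "?P CARD('a)"
    using ex_zero_sum_subsequence_card[where 'a = 'a] by simp
  then have "?P (davenport TYPE('a))"
    unfolding davenport_def by (rule LeastI)
  then show ?thesis
    using assms by blast
qed

lemma ex_zero_sum_index_set:
  fixes g :: "'i \<Rightarrow> 'a::{ab_group_add, finite}"
  assumes "finite X" "davenport TYPE('a) \<le> card X"
  obtains Z where "Z \<subseteq> X" "Z \<noteq> {}" "sum g Z = 0"
proof -
  obtain T where T: "T \<subseteq># terms g X" "T \<noteq> {#}" "\<Sum>\<^sub># T = 0"
    using ex_zero_sum_subsequence_davenport[of "terms g X"] assms(2) by auto
  then obtain Z where "Z \<subseteq> X" "T = terms g Z"
    using subseteq_terms[OF assms(1)] by blast
  then show thesis
    using that[of Z] T by (cases "Z = {}") (auto simp: sum_mset_terms)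
qed

text \<open>Negating the terms of one solution \<open>I\<close> turns every other solution \<open>J\<close> into the zero-sum set
  \<open>sym_diff I J\<close>, so the Davenport constant produces a second solution.\<close>

lemma ex_index_both_sets_with_sum_nonempty:
  fixes g :: "'i \<Rightarrow> 'a::{ab_group_add, finite}"
  assumes "finite X" "davenport TYPE('a) \<le> card X" "sets_with_sum g X h \<noteq> {}"
  obtains i where "i \<in> X" "sets_with_sum g (X - {i}) h \<noteq> {}" "sets_with_sum g (X - {i}) (h - g i) \<noteq> {}"
proof -
  obtain I where I: "I \<in> sets_with_sum g X h"
    using assms(3) by blast
  obtain Z where Z: "Z \<subseteq> X" "Z \<noteq> {}" "(\<Sum>i\<in>Z. if i \<in> I then - g i else g i) = 0"
    using ex_zero_sum_index_set[OF assms(1,2)] by blast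
  have "finite I" "finite Z"
    using assms(1) I Z finite_subset by (auto simp: mem_sets_with_sum_iff)
  then have IZ: "sym_diff I Z \<in> sets_with_sum g X h"
    using I Z sum_sym_diff[of I Z g] by (auto simp: mem_sets_with_sum_iff)
  obtain i where i: "i \<in> Z"
    using Z(2) by blast
  have "{J \<in> sets_with_sum g X h. i \<notin> J} \<noteq> {}" "{J \<in> sets_with_sum g X h. i \<in> J} \<noteq> {}"
    using I IZ i by blast+
  moreover have "{J \<in> sets_with_sum g X h. i \<in> J} = insert i ` sets_with_sum g (X - {i}) (h - g i)"
    using bij_betw_imp_surj_on[OF bij_betw_insert_sets_with_sum[OF assms(1), of i g h]] i Z(1) by auto
  ultimately show thesis
    using that[of i] i Z(1) by (auto simp: sets_with_sum_avoiding)
qed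

lemma card_sets_with_sum_lower_bound:
  fixes g :: "'i \<Rightarrow> 'a::{ab_group_add, finite}"
  assumes "finite X" "sets_with_sum g X h \<noteq> {}"
  shows "2 ^ (card X + 1) \<le> 2 ^ davenport TYPE('a) * card (sets_with_sum g X h)"
  using assms
proof (induction X arbitrary: h rule: finite_psubset_induct)
  case (psubset X)
  let ?D = "davenport TYPE('a)"
  show ?case
  proof (cases "?D \<le> card X")
    case True
    then obtain i where i: "i \<in> X"
      and nonempty: "sets_with_sum g (X - {i}) h \<noteq> {}" "sets_with_sum g (X - {i}) (h - g i) \<noteq> {}"
      using ex_index_both_sets_with_sum_nonempty psubset by metis
    have "X - {i} \<subset> X" "card (X - {i}) + 1 = card X"
      using i psubset.hyps card_Suc_Diff1[of X i] by auto
    then have "2 ^ card X \<le> 2 ^ ?D * card (sets_with_sum g (X - {i}) h)"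
      "2 ^ card X \<le> 2 ^ ?D * card (sets_with_sum g (X - {i}) (h - g i))"
      using psubset.IH nonempty by metis+
    then show ?thesis
      by (simp add: card_sets_with_sum_remove[OF psubset.hyps i] distrib_left)
  next
    case False
    then have "(2::nat) ^ (card X + 1) \<le> 2 ^ ?D"
      by (intro power_increasing) auto
    moreover have "1 \<le> card (sets_with_sum g X h)"
      using psubset finite_sets_with_sum by (simp add: Suc_le_eq card_gt_0_iff)
    ultimately show ?thesis
      by (metis le_trans mult.right_neutral mult_le_mono2)
  qed
qed

section \<open>Extremal families\<close>

text \<open>The factor \<open>2 ^ D(G)\<close> avoids the exponent \<open>|X| - D(G) + 1\<close>, which natural number subtraction
  would truncate.\<close>

definition extremal :: "('i \<Rightarrow> 'a::{ab_group_add, finite}) \<Rightarrow> 'i set \<Rightarrow> bool" where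
  "extremal g X \<longleftrightarrow> finite X \<and>
    2 ^ davenport TYPE('a) * card (zero_sum_sets g X) = 2 ^ (card X + 1)"

lemma extremal_card_halves:
  fixes g :: "'i \<Rightarrow> 'a::{ab_group_add, finite}"
  assumes "extremal g X" "i \<in> \<Union>(zero_sum_sets g X)"
  shows "2 ^ davenport TYPE('a) * card (zero_sum_sets g (X - {i})) = 2 ^ card X"
    and "2 ^ davenport TYPE('a) * card {I \<in> zero_sum_sets g X. i \<in> I} = 2 ^ card X"
proof -
  let ?D = "davenport TYPE('a)"
  let ?avoid = "zero_sum_sets g (X - {i})" and ?contain = "sets_with_sum g (X - {i}) (0 - g i)"
  have X: "finite X" "i \<in> X"
    using assms by (auto simp: extremal_def mem_sets_with_sum_iff)
  have "{} \<in> ?avoid"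
    by (simp add: mem_sets_with_sum_iff)
  moreover have "?contain \<noteq> {}"
    using bij_betw_insert_sets_with_sum[OF X, of g 0] assms(2) by (auto simp: bij_betw_def)
  ultimately have "2 ^ card X \<le> 2 ^ ?D * card ?avoid" "2 ^ card X \<le> 2 ^ ?D * card ?contain"
    using card_sets_with_sum_lower_bound[of "X - {i}" g] X(1) card_Suc_Diff1[OF X]
    by (auto simp flip: power_Suc)
  moreover have "2 ^ ?D * card ?avoid + 2 ^ ?D * card ?contain = 2 ^ card X + 2 ^ card X"
    using assms(1) by (simp add: extremal_def card_sets_with_sum_remove[OF X] distrib_left)
  ultimately have "2 ^ ?D * card ?avoid = 2 ^ card X" "2 ^ ?D * card ?contain = 2 ^ card X"
    by linarith+
  then show "2 ^ ?D * card ?avoid = 2 ^ card X"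
    and "2 ^ ?D * card {I \<in> zero_sum_sets g X. i \<in> I} = 2 ^ card X"
    by (simp_all only: card_sets_with_sum_containing[OF X])
qed

lemma extremal_remove:
  fixes g :: "'i \<Rightarrow> 'a::{ab_group_add, finite}"
  assumes "extremal g X" "i \<in> \<Union>(zero_sum_sets g X)"
  shows "extremal g (X - {i})"
proof -
  have X: "finite X" "i \<in> X"
    using assms by (auto simp: extremal_def mem_sets_with_sum_iff)
  then show ?thesis
    using extremal_card_halves(1)[OF assms] card_Suc_Diff1[OF X] by (simp add: extremal_def flip: power_Suc)
qed

lemma extremal_card_containing_eq_avoiding:
  fixes g :: "'i \<Rightarrow> 'a::{ab_group_add, finite}"
  assumes "extremal g X" "i \<in> \<Union>(zero_sum_sets g X)"
  shows "card {I \<in> zero_sum_sets g X. i \<in> I} = card {I \<in> zero_sum_sets g X. i \<notin> I}"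
proof -
  have "2 ^ davenport TYPE('a) * card {I \<in> zero_sum_sets g X. i \<in> I} =
    2 ^ davenport TYPE('a) * card {I \<in> zero_sum_sets g X. i \<notin> I}"
    by (simp only: extremal_card_halves[OF assms] sets_with_sum_avoiding)
  then show ?thesis
    by simp
qed

lemma coprime_card_zero_sum_sets:
  fixes g :: "'i \<Rightarrow> 'a::{ab_group_add, finite}"
  assumes "extremal g X" "odd n"
  shows "coprime (card (zero_sum_sets g X)) n"
proof -
  have "card (zero_sum_sets g X) dvd 2 ^ (card X + 1)"
    using assms(1) unfolding extremal_def by (metis dvd_triv_right)
  moreover have "coprime (2 ^ (card X + 1)) n"
    using assms(2) by simp
  ultimately show ?thesis
    by (meson coprime_divisors dvd_refl)
qed

lemma Union_zero_sum_sets_mem: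
  fixes g :: "'i \<Rightarrow> 'a::{ab_group_add, finite}"
  assumes "odd CARD('a)" "extremal g X"
  shows "\<Union>(zero_sum_sets g X) \<in> zero_sum_sets g X"
proof -
  let ?F = "zero_sum_sets g X" and ?U = "\<Union>(zero_sum_sets g X)"
  have U: "?U \<subseteq> X"
    by (auto simp: mem_sets_with_sum_iff)
  then have fin: "finite ?F" "finite ?U"
    using assms(2) by (auto simp: extremal_def finite_sets_with_sum intro: finite_subset)
  have "0 = (\<Sum>I\<in>?F. sum g (?U \<inter> I))"
    by (intro sum.neutral[symmetric] ballI) (auto simp: mem_sets_with_sum_iff Int_absorb1 Union_upper)
  also have "\<dots> = (\<Sum>I\<in>?F. sum g (?U - I))"
    using fin extremal_card_containing_eq_avoiding[OF assms(2)] by (rule sum_sum_Int_eq_sum_sum_Diff)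
  also have "\<dots> = (\<Sum>_\<in>?F. sum g ?U)"
  proof (rule sum.cong)
    fix I assume I: "I \<in> ?F"
    then show "sum g (?U - I) = sum g ?U"
      using sum_diff[OF fin(2) Union_upper[OF I], of g] by (simp add: mem_sets_with_sum_iff)
  qed simp
  finally have "sum g ?U = 0"
    using coprime_sum_const_eq_0_imp_eq_0[OF fin(1) coprime_card_zero_sum_sets[OF assms(2,1)]] by simp
  then show ?thesis
    using U by (simp add: mem_sets_with_sum_iff)
qed

lemma ex_least_zero_sum_set_containing:
  fixes g :: "'i \<Rightarrow> 'a::{ab_group_add, finite}"
  assumes "odd CARD('a)" "extremal g X" "i \<in> \<Union>(zero_sum_sets g X)"
  obtains M where "M \<in> zero_sum_sets g X" "i \<in> M"
    and "\<And>I. I \<in> zero_sum_sets g X \<Longrightarrow> i \<in> I \<Longrightarrow> M \<subseteq> I"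
proof -
  let ?U = "\<Union>(zero_sum_sets g X)" and ?V = "\<Union>(zero_sum_sets g (X - {i}))"
  have fin: "finite X"
    using assms(2) by (simp add: extremal_def)
  have U: "?U \<in> zero_sum_sets g X"
    using assms(1,2) by (rule Union_zero_sum_sets_mem)
  have "?V \<in> zero_sum_sets g (X - {i})"
    using assms(1) extremal_remove[OF assms(2,3)] by (rule Union_zero_sum_sets_mem)
  then have V: "?V \<in> zero_sum_sets g X" "i \<notin> ?V"
    by (auto simp flip: sets_with_sum_avoiding)
  have "?U - ?V \<in> zero_sum_sets g X"
    using V(1) by (intro zero_sum_sets_Diff[OF fin U]) auto
  moreover have "?U - ?V \<subseteq> I" if I: "I \<in> zero_sum_sets g X" "i \<in> I" for I
  proof -
    have "?U - I \<in> zero_sum_sets g X"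
      using I(1) by (intro zero_sum_sets_Diff[OF fin U]) auto
    then have "?U - I \<in> zero_sum_sets g (X - {i})"
      using I(2) by (simp flip: sets_with_sum_avoiding)
    then show ?thesis
      by blast
  qed
  ultimately show thesis
    using that[of "?U - ?V"] assms(3) V(2) by blast
qed

lemma minimal_zero_sum_set_subset:
  fixes g :: "'i \<Rightarrow> 'a::{ab_group_add, finite}"
  assumes "odd CARD('a)" "extremal g X"
    and "I \<in> minimal_zero_sum_sets g X" "Z \<in> zero_sum_sets g X" "i \<in> I" "i \<in> Z"
  shows "I \<subseteq> Z"
proof -
  obtain M where M: "M \<in> zero_sum_sets g X" "i \<in> M"
    and least: "\<And>J. J \<in> zero_sum_sets g X \<Longrightarrow> i \<in> J \<Longrightarrow> M \<subseteq> J"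
    using ex_least_zero_sum_set_containing[OF assms(1,2)] assms(4,6) by blast
  have "M = I"
    using minimal_zero_sum_setsD[OF assms(3)] M least assms(5) by blast
  then show ?thesis
    using least assms(4,6) by blast
qed

lemma disjoint_minimal_zero_sum_sets:
  fixes g :: "'i \<Rightarrow> 'a::{ab_group_add, finite}"
  assumes "odd CARD('a)" "extremal g X"
  shows "pairwise disjnt (minimal_zero_sum_sets g X)"
proof (rule pairwiseI, rule ccontr)
  fix I J assume IJ: "I \<in> minimal_zero_sum_sets g X" "J \<in> minimal_zero_sum_sets g X" "I \<noteq> J"
    and "\<not> disjnt I J"
  then obtain i where "i \<in> I" "i \<in> J"
    by (auto simp: disjnt_def)
  then have "I \<subseteq> J" "J \<subseteq> I"
    using minimal_zero_sum_set_subset[OF assms] IJ(1,2) minimal_zero_sum_setsD(1) by metis+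
  then show False
    using IJ(3) by blast
qed

text \<open>A term occurring in both \<open>I\<close> and \<open>J\<close> could be moved from \<open>I\<close> to its position in \<open>J\<close>; the
  resulting zero-sum set meets \<open>J\<close> in that position only, yet it must contain \<open>J\<close>.\<close>

lemma disjoint_terms_minimal_zero_sum_sets:
  fixes g :: "'i \<Rightarrow> 'a::{ab_group_add, finite}"
  assumes "odd CARD('a)" "extremal g X" "0 \<notin> g ` X"
    and I: "I \<in> minimal_zero_sum_sets g X" and J: "J \<in> minimal_zero_sum_sets g X" and "I \<noteq> J"
  shows "terms g I \<inter># terms g J = {#}"
proof (rule ccontr)
  assume "terms g I \<inter># terms g J \<noteq> {#}"
  then obtain x where x: "x \<in># terms g I" "x \<in># terms g J"
    by (metis multiset_nonemptyE Multiset.inter_iff)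
  have sub: "I \<subseteq> X" "J \<subseteq> X" and sum: "sum g I = 0" "sum g J = 0"
    using I J minimal_zero_sum_setsD(1) by (auto simp: mem_sets_with_sum_iff)
  then have fin: "finite I" "finite J"
    using assms(2) finite_subset by (auto simp: extremal_def)
  obtain i j where ij: "i \<in> I" "j \<in> J" "g i = g j"
    using x fin by auto
  have disj: "I \<inter> J = {}"
    using disjoint_minimal_zero_sum_sets[OF assms(1,2)] I J \<open>I \<noteq> J\<close> by (auto simp: pairwise_def disjnt_def)
  then have "j \<notin> I"
    using ij(2) by blast
  then have "sum g (insert j (I - {i})) = 0"
    using sum(1) fin(1) ij by (simp add: sum_diff1)
  then have "insert j (I - {i}) \<in> zero_sum_sets g X"
    using sub ij(2) by (auto simp: mem_sets_with_sum_iff)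
  then have "J \<subseteq> insert j (I - {i})"
    using minimal_zero_sum_set_subset[OF assms(1,2) J] ij(2) by blast
  then have "J = {j}"
    using disj ij(2) by blast
  then show False
    using sub(2) sum(2) assms(3) by force
qed

lemma inj_on_terms_minimal_zero_sum_sets:
  fixes g :: "'i \<Rightarrow> 'a::{ab_group_add, finite}"
  assumes "odd CARD('a)" "extremal g X" "0 \<notin> g ` X"
  shows "inj_on (terms g) (minimal_zero_sum_sets g X)"
proof (rule inj_onI, rule ccontr)
  fix I J assume IJ: "I \<in> minimal_zero_sum_sets g X" "J \<in> minimal_zero_sum_sets g X"
    "terms g I = terms g J" "I \<noteq> J"
  then have "terms g I = {#}"
    using disjoint_terms_minimal_zero_sum_sets[OF assms] by (metis subset_mset.inf.idem)
  moreover have "terms g I \<in> {T. T \<subseteq># terms g X \<and> minimal_zero_sum T}"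
    using IJ(1) assms(2) image_terms_minimal_zero_sum_sets[of X g] by (auto simp: extremal_def)
  ultimately show False
    by (simp add: minimal_zero_sum_def)
qed

lemma extremal_card_minimal_zero_sum_sets:
  fixes g :: "'i \<Rightarrow> 'a::{ab_group_add, finite}"
  assumes "odd CARD('a)" "extremal g X"
  shows "davenport TYPE('a) + card (minimal_zero_sum_sets g X) = card X + 1"
proof -
  have "finite X"
    using assms(2) by (simp add: extremal_def)
  then have "card (zero_sum_sets g X) = 2 ^ card (minimal_zero_sum_sets g X)"
    using disjoint_minimal_zero_sum_sets[OF assms] by (rule card_zero_sum_sets_if_disjoint)
  then have "(2::nat) ^ (davenport TYPE('a) + card (minimal_zero_sum_sets g X)) = 2 ^ (card X + 1)"
    using assms(2) by (simp add: extremal_def power_add)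
  then show ?thesis
    by (rule power_inject_exp[THEN iffD1, rotated]) simp
qed

lemma extremal_nth_iff:
  fixes xs :: "'a::{ab_group_add, finite} list"
  shows "extremal ((!) xs) {..<length xs} \<longleftrightarrow>
    real (N0 (mset xs)) = 2 powi (int (length xs) - int (davenport TYPE('a)) + 1)"
proof -
  let ?D = "davenport TYPE('a)" and ?n = "length xs"
  have powi: "(2::real) ^ ?D * 2 powi (int ?n - int ?D + 1) = 2 ^ (?n + 1)"
    by (simp add: power_int_add power_int_diff)
  have "real (N0 (mset xs)) = 2 powi (int ?n - int ?D + 1) \<longleftrightarrow>
    2 ^ ?D * real (N0 (mset xs)) = 2 ^ ?D * 2 powi (int ?n - int ?D + 1)"
    by simp
  also have "\<dots> \<longleftrightarrow> real (2 ^ ?D * N0 (mset xs)) = real (2 ^ (?n + 1))"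
    unfolding powi by simp
  also have "\<dots> \<longleftrightarrow> extremal ((!) xs) {..<?n}"
    by (simp only: of_nat_eq_iff extremal_def N0_mset sets_with_sum_def finite_lessThan card_lessThan
        simp_thms)
  finally show ?thesis
    by simp
qed

theorem theorem3p5:
  fixes S :: "'a::{ab_group_add, finite} multiset"
  assumes "odd CARD('a)"
    and "0 \<notin># S"
    and "real (N0 S) = 2 powi (int (size S) - int (davenport TYPE('a)) + 1)"
  shows "int (card {T. T \<subseteq># S \<and> minimal_zero_sum T}) = int (size S) - int (davenport TYPE('a)) + 1
    \<and> pairwise (\<lambda>T\<^sub>1 T\<^sub>2. T\<^sub>1 \<inter># T\<^sub>2 = {#}) {T. T \<subseteq># S \<and> minimal_zero_sum T}"
proof -
  obtain xs where xs: "mset xs = S"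
    using ex_mset by blast
  define X g where "X = {..<length xs}" and "g = (!) xs"
  let ?M = "minimal_zero_sum_sets g X"
  have extremal: "extremal g X" and nonzero: "0 \<notin> g ` X"
    using assms(2,3) by (auto simp: X_def g_def extremal_nth_iff in_set_conv_nth simp flip: xs)
  have subseqs: "{T. T \<subseteq># S \<and> minimal_zero_sum T} = terms g ` ?M"
    using image_terms_minimal_zero_sum_sets[of X g] terms_nth[of xs] xs by (simp add: X_def g_def)
  have "card (terms g ` ?M) = card ?M"
    using inj_on_terms_minimal_zero_sum_sets[OF assms(1) extremal nonzero] by (rule card_image)
  moreover have "davenport TYPE('a) + card ?M = size S + 1"
    using extremal_card_minimal_zero_sum_sets[OF assms(1) extremal] xs by (auto simp: X_def)
  moreover have "pairwise (\<lambda>T\<^sub>1 T\<^sub>2. T\<^sub>1 \<inter># T\<^sub>2 = {#}) (terms g ` ?M)"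
    using disjoint_terms_minimal_zero_sum_sets[OF assms(1) extremal nonzero]
    by (auto simp: pairwise_def)
  ultimately show ?thesis
    unfolding subseqs by linarith
qed

end
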